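(* Consider $n$ i.i.d. observations from the linear model $Y_i=\boldsymbol{X}_i^\top\boldsymbol{\beta}^*+\varepsilon_i$, $\boldsymbol{\beta}^*\in\mathbb{R}^p$, where $\varepsilon_i\sim U([-a,a])$ with $a>0$ a constant, and $\boldsymbol{X}_i\in\mathbb{R}^p$ is any random design independent of the errors. Let $$\mathcal{R} := \frac{a^2 p}{16\Big(\inf_{\mathbf{R}\in\mathcal{O}}\max_{j\in\{1,\dots,p\}} \mathbb{E}\sum_{i=1}^n |(\boldsymbol{X}_i^\top\mathbf{R})_j|\Big)^2},$$ where $\mathcal{O}$ is the set of all $p\times p$ orthogonal matrices and the expectation is over the design. Then $$\inf_{\hat{\boldsymbol{\beta}}}\sup_{\boldsymbol{\beta}^*\in\mathbb{R}^p}\mathbb{E}_{\boldsymbol{\beta}^*}\|\hat{\boldsymbol{\beta}}-\boldsymbol{\beta}^*\|^2\ge\mathcal{R},$$ and in addition $$\inf_{\hat{\boldsymbol{\beta}}}\sup_{\boldsymbol{\beta}^*\in\mathbb{R}^p}\mathbb{P}_{\boldsymbol{\beta}^*}\big(\|\hat{\boldsymbol{\beta}}-\boldsymbol{\beta}^*\|\ge\sqrt{\mathcal{R}/2}\big)\ge\frac{1}{2^8}.$$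
   Context: $\|\cdot\|$ is the Euclidean norm. The infima are over all estimators, i.e. measurable functions of the data $(\boldsymbol{X}_i,Y_i)_{i=1}^n$ with values in $\mathbb{R}^p$. $\mathbb{E}_{\boldsymbol{\beta}^*}$ and $\mathbb{P}_{\boldsymbol{\beta}^*}$ denote expectation and probability (over both design and noise) when the true parameter is $\boldsymbol{\beta}^*$. $(\boldsymbol{X}_i^\top\mathbf{R})_j$ is the $j$-th coordinate of the row vector $\boldsymbol{X}_i^\top\mathbf{R}$. *)

theory Defs
  imports "HOL-Probability.Probability"
begin

text \<open>
  Design and noise live on one probability space \<open>M\<close> that does not depend on the parameter; the
  parameter \<open>\<beta>\<close> enters only through the responses. Expectation and probability under \<open>\<beta>\<close> are
  therefore integration and measure over \<open>M\<close> of functions of the observations generated with \<open>\<beta>\<close>.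
\<close>

definition observation ::
  "(nat \<Rightarrow> 'w \<Rightarrow> real ^ 'p) \<Rightarrow> (nat \<Rightarrow> 'w \<Rightarrow> real) \<Rightarrow> real ^ 'p \<Rightarrow> nat \<Rightarrow> 'w \<Rightarrow> (real ^ 'p) \<times> real"
  where "observation X \<epsilon> \<beta> i \<omega> = (X i \<omega>, X i \<omega> \<bullet> \<beta> + \<epsilon> i \<omega>)"

definition sample ::
  "nat \<Rightarrow> (nat \<Rightarrow> 'w \<Rightarrow> real ^ 'p) \<Rightarrow> (nat \<Rightarrow> 'w \<Rightarrow> real) \<Rightarrow> real ^ 'p \<Rightarrow> 'w
    \<Rightarrow> (nat \<Rightarrow> (real ^ 'p) \<times> real)"
  where "sample n X \<epsilon> \<beta> \<omega> = (\<lambda>i\<in>{1..n}. observation X \<epsilon> \<beta> i \<omega>)"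

locale uniform_linear_model = prob_space M
  for M :: "'w measure" +
  fixes n :: nat and a :: real
    and X :: "nat \<Rightarrow> 'w \<Rightarrow> real ^ 'p" and \<epsilon> :: "nat \<Rightarrow> 'w \<Rightarrow> real"
  assumes a_pos: "a > 0"
    and observations_indep:
      "\<And>\<beta>. indep_vars (\<lambda>_. borel \<Otimes>\<^sub>M borel) (observation X \<epsilon> \<beta>) {1..n}"
    and observations_ident:
      "\<And>\<beta> i j. i \<in> {1..n} \<Longrightarrow> j \<in> {1..n} \<Longrightarrow>
         distr M (borel \<Otimes>\<^sub>M borel) (observation X \<epsilon> \<beta> i)
           = distr M (borel \<Otimes>\<^sub>M borel) (observation X \<epsilon> \<beta> j)"
    and errors_uniform:
      "\<And>i. i \<in> {1..n} \<Longrightarrow> distr M borel (\<epsilon> i) = uniform_measure lborel {-a..a}"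
    and design_indep_errors:
      "indep_set
         (sets (vimage_algebra (space M) (\<lambda>\<omega>. \<lambda>i\<in>{1..n}. X i \<omega>) (Pi\<^sub>M {1..n} (\<lambda>_. borel))))
         (sets (vimage_algebra (space M) (\<lambda>\<omega>. \<lambda>i\<in>{1..n}. \<epsilon> i \<omega>) (Pi\<^sub>M {1..n} (\<lambda>_. borel))))"

text \<open>
  The independence of design and errors is that of the generated \<open>\<sigma>\<close>-algebras, because
  \<open>indep_var\<close> needs both random variables to have the same type.
\<close>

definition estimators :: "nat \<Rightarrow> ((nat \<Rightarrow> (real ^ 'p) \<times> real) \<Rightarrow> real ^ 'p) set"
  where "estimators n = Pi\<^sub>M {1..n} (\<lambda>_. borel \<Otimes>\<^sub>M borel) \<rightarrow>\<^sub>M borel"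

text \<open>
  The expectation is taken in \<open>[0, \<infinity>]\<close>, so a non-integrable design yields \<open>\<infinity>\<close> (and not the
  default value \<open>0\<close> of the Bochner integral).
\<close>

definition design_size :: "'w measure \<Rightarrow> nat \<Rightarrow> (nat \<Rightarrow> 'w \<Rightarrow> real ^ 'p) \<Rightarrow> ennreal"
  where "design_size M n X =
    (INF Q\<in>{Q :: real ^ 'p ^ 'p. orthogonal_matrix Q}.
       MAX j. \<integral>\<^sup>+\<omega>. ennreal (\<Sum>i=1..n. \<bar>(X i \<omega> v* Q) $ j\<bar>) \<partial>M)"

text \<open>
  The quotient is that of \<open>[0, \<infinity>]\<close>: \<open>rate\<close> is \<open>\<infinity>\<close> if \<open>design_size\<close> is \<open>0\<close>, and \<open>0\<close> if
  \<open>design_size\<close> is \<open>\<infinity>\<close>.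
\<close>

definition rate :: "'w measure \<Rightarrow> nat \<Rightarrow> real \<Rightarrow> (nat \<Rightarrow> 'w \<Rightarrow> real ^ 'p) \<Rightarrow> ennreal"
  where "rate M n a X = ennreal (a\<^sup>2 * real CARD('p)) / (16 * (design_size M n X)\<^sup>2)"

end

theory Submission imports Defs begin

text \<open>
  Put a cube with side \<open>\<delta>\<close> into the parameter space, with axes along the columns of an orthogonal
  matrix. Conditionally on the design, moving the parameter along an edge shifts the \<open>i\<close>-th uniform
  error by \<open>\<delta> \<bar>(X\<^sub>i\<^sup>T Q)\<^sub>j\<bar>\<close>, so it changes the law of the sample in total variation by at most
  the expected sum of these shifts over \<open>2 a\<close>. If every edge costs at most \<open>1 / 2\<close>, some vertex has
  risk at least \<open>p \<delta>\<^sup>2 / 8\<close>, even for the estimator clipped to the cube. The choice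
  \<open>\<delta> = a / (\<surd>2 D)\<close>, with \<open>D\<close> the design size, makes this the rate, and the factor \<open>\<surd>2\<close> is the
  slack that makes an almost optimal \<open>Q\<close> sufficient. Since the clipped loss is at most \<open>p \<delta>\<^sup>2\<close>, large
  expected loss forces large loss with probability at least \<open>1 / 16\<close>.
\<close>

section \<open>The cost of shifting uniform noise\<close>

text \<open>After a change of variables both sides integrate \<open>f\<close> over intervals of
  length \<open>2 * a\<close>, one being the other moved by \<open>h\<close>. What the first
  interval has outside the second has length at most \<open>\<bar>h\<bar>\<close>, and there
  \<open>f\<close> is at most \<open>c\<close>.\<close>

lemma nn_integral_uniform_shift_le:
  fixes f :: "real \<Rightarrow> ennreal" and a c h :: real
  assumes f[measurable]: "f \<in> borel_measurable borel" and a: "a > 0" and c: "c \<ge> 0"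
    and le: "\<And>y. f y \<le> ennreal c"
  shows "(\<integral>\<^sup>+y. f y \<partial>uniform_measure lborel {-a..a})
    \<le> (\<integral>\<^sup>+y. f (y + h) \<partial>uniform_measure lborel {-a..a}) + ennreal (c * (\<bar>h\<bar> / (2 * a)))"
proof -
  \<comment> \<open>\<open>B\<close> covers the part of \<open>{-a..a}\<close> that lies outside
    \<open>{-a+h..a+h}\<close>. For \<open>\<bar>h\<bar> > 2 * a\<close> it is larger than needed,
    which only weakens a bound that is trivial there.\<close>
  define B where "B = (if h \<ge> 0 then {-a..-a+h} else {a+h..a})"
  have B: "emeasure lborel B = ennreal \<bar>h\<bar>" "B \<in> sets lborel"
    by (auto simp: B_def)
  have "(\<integral>\<^sup>+y. f y * indicator {-a..a} y \<partial>lborel)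
      \<le> (\<integral>\<^sup>+y. f y * indicator {-a..a} (y - h) + ennreal c * indicator B y \<partial>lborel)"
    using le by (intro nn_integral_mono) (auto simp: B_def indicator_def add_increasing)
  also have "\<dots> = (\<integral>\<^sup>+y. f y * indicator {-a..a} (y - h) \<partial>lborel) + ennreal c * ennreal \<bar>h\<bar>"
    using B by (subst nn_integral_add) (auto simp: nn_integral_cmult)
  also have "(\<integral>\<^sup>+y. f y * indicator {-a..a} (y - h) \<partial>lborel)
      = (\<integral>\<^sup>+y. f (y + h) * indicator {-a..a} y \<partial>lborel)"
    by (subst nn_integral_real_affine[where c = 1 and t = h]) (auto simp: add.commute)
  finally have *: "(\<integral>\<^sup>+y. f y * indicator {-a..a} y \<partial>lborel)
      \<le> (\<integral>\<^sup>+y. f (y + h) * indicator {-a..a} y \<partial>lborel) + ennreal (c * \<bar>h\<bar>)"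
    using c by (simp add: ennreal_mult)
  have "(\<integral>\<^sup>+y. f y * indicator {-a..a} y \<partial>lborel) / ennreal (2 * a)
      \<le> ((\<integral>\<^sup>+y. f (y + h) * indicator {-a..a} y \<partial>lborel) + ennreal (c * \<bar>h\<bar>)) / ennreal (2 * a)"
    by (rule divide_right_mono_ennreal[OF *])
  also have "\<dots> = (\<integral>\<^sup>+y. f (y + h) * indicator {-a..a} y \<partial>lborel) / ennreal (2 * a)
      + ennreal (c * (\<bar>h\<bar> / (2 * a)))"
    using a c by (simp add: add_divide_distrib_ennreal divide_ennreal)
  finally show ?thesis
    using a by (simp add: nn_integral_uniform_measure)
qed

text \<open>Coordinates are shifted one at a time and the costs add up: the new coordinate is
  handled by the one-dimensional bound with the others fixed, the rest by the induction
  hypothesis.\<close>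

lemma nn_integral_PiM_uniform_shift_le:
  fixes F :: "('i \<Rightarrow> real) \<Rightarrow> ennreal" and a c :: real and h :: "'i \<Rightarrow> real"
  assumes "finite I" and F: "F \<in> borel_measurable (Pi\<^sub>M I (\<lambda>_. uniform_measure lborel {-a..a}))"
    and a: "a > 0" and c: "c \<ge> 0"
    and le: "\<And>x. F x \<le> ennreal c"
  shows "(\<integral>\<^sup>+x. F x \<partial>Pi\<^sub>M I (\<lambda>_. uniform_measure lborel {-a..a}))
    \<le> (\<integral>\<^sup>+x. F (\<lambda>i\<in>I. x i + h i) \<partial>Pi\<^sub>M I (\<lambda>_. uniform_measure lborel {-a..a}))
      + ennreal (c * ((\<Sum>i\<in>I. \<bar>h i\<bar>) / (2 * a)))"
proof -
  define U where "U = uniform_measure lborel {-a..a}"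
  have [measurable_cong]: "sets U = sets borel" by (simp add: U_def)
  interpret U: prob_space U
    unfolding U_def by (rule prob_space_uniform_measure) (use a in auto)
  interpret product_prob_space "\<lambda>_::'i. U" by standard
  have "(\<integral>\<^sup>+x. F x \<partial>Pi\<^sub>M I (\<lambda>_. U))
    \<le> (\<integral>\<^sup>+x. F (\<lambda>i\<in>I. x i + h i) \<partial>Pi\<^sub>M I (\<lambda>_. U)) + ennreal (c * ((\<Sum>i\<in>I. \<bar>h i\<bar>) / (2 * a)))"
    using \<open>finite I\<close> F[folded U_def] le
  proof (induction I arbitrary: F)
    case empty
    show ?case by (simp add: PiM_empty nn_integral_count_space_finite restrict_def)
  next
    case (insert i I)
    note [measurable] = insert.prems(1)
    \<comment> \<open>The new coordinate is averaged out after its shift. Since \<open>U\<close> has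
      mass one, \<open>H\<close> is again bounded by \<open>c\<close>, as the induction hypothesis
      requires; this is why \<open>F\<close> is arbitrary in the induction.\<close>
    define H where "H x = (\<integral>\<^sup>+y. F (x(i := y + h i)) \<partial>U)" for x
    have Hm: "H \<in> borel_measurable (Pi\<^sub>M I (\<lambda>_. U))"
      unfolding H_def by measurable
    have Hle: "H x \<le> ennreal c" for x
    proof -
      have "H x \<le> (\<integral>\<^sup>+y. ennreal c \<partial>U)"
        unfolding H_def by (intro nn_integral_mono insert.prems)
      then show ?thesis by (simp add: U.emeasure_space_1)
    qed
    interpret PI: prob_space "Pi\<^sub>M I (\<lambda>_. U)" by (rule prob_space_PiM) (rule U.prob_space_axioms)
    have "(\<integral>\<^sup>+x. F x \<partial>Pi\<^sub>M (insert i I) (\<lambda>_. U)) = (\<integral>\<^sup>+x. \<integral>\<^sup>+y. F (x(i := y)) \<partial>U \<partial>Pi\<^sub>M I (\<lambda>_. U))"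
      by (rule product_nn_integral_insert) (use insert in auto)
    also have "\<dots> \<le> (\<integral>\<^sup>+x. H x + ennreal (c * (\<bar>h i\<bar> / (2 * a))) \<partial>Pi\<^sub>M I (\<lambda>_. U))"
    proof (intro nn_integral_mono)
      fix x assume x: "x \<in> space (Pi\<^sub>M I (\<lambda>_. U))"
      have "(\<lambda>y. F (x(i := y))) \<in> borel_measurable U"
        using x by measurable
      then have "(\<lambda>y. F (x(i := y))) \<in> borel_measurable borel"
        by (simp cong: measurable_cong_sets add: U_def)
      from nn_integral_uniform_shift_le[OF this a c insert.prems(2)]
      show "(\<integral>\<^sup>+y. F (x(i := y)) \<partial>U) \<le> H x + ennreal (c * (\<bar>h i\<bar> / (2 * a)))"
        unfolding H_def U_def .
    qed
    also have "\<dots> = (\<integral>\<^sup>+x. H x \<partial>Pi\<^sub>M I (\<lambda>_. U)) + ennreal (c * (\<bar>h i\<bar> / (2 * a)))"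
      using Hm by (simp add: nn_integral_add PI.emeasure_space_1)
    also have "\<dots> \<le> (\<integral>\<^sup>+x. H (\<lambda>k\<in>I. x k + h k) \<partial>Pi\<^sub>M I (\<lambda>_. U))
       + ennreal (c * ((\<Sum>k\<in>I. \<bar>h k\<bar>) / (2 * a))) + ennreal (c * (\<bar>h i\<bar> / (2 * a)))"
      by (intro add_right_mono insert.IH Hm Hle)
    also have "(\<integral>\<^sup>+x. H (\<lambda>k\<in>I. x k + h k) \<partial>Pi\<^sub>M I (\<lambda>_. U))
       = (\<integral>\<^sup>+x. \<integral>\<^sup>+y. F (\<lambda>k\<in>insert i I. (x(i := y)) k + h k) \<partial>U \<partial>Pi\<^sub>M I (\<lambda>_. U))"
    proof -
      have "(\<lambda>k\<in>I. x k + h k)(i := y + h i) = (\<lambda>k\<in>insert i I. (x(i := y)) k + h k)" for x y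
        using insert.hyps by (auto simp: fun_eq_iff)
      then show ?thesis by (simp only: H_def)
    qed
    also have "\<dots> = (\<integral>\<^sup>+x. F (\<lambda>k\<in>insert i I. x k + h k) \<partial>Pi\<^sub>M (insert i I) (\<lambda>_. U))"
      by (rule product_nn_integral_insert[symmetric]) (use insert in auto)
    also have "(\<integral>\<^sup>+x. F (\<lambda>k\<in>insert i I. x k + h k) \<partial>Pi\<^sub>M (insert i I) (\<lambda>_. U))
          + ennreal (c * ((\<Sum>k\<in>I. \<bar>h k\<bar>) / (2 * a))) + ennreal (c * (\<bar>h i\<bar> / (2 * a)))
        = (\<integral>\<^sup>+x. F (\<lambda>k\<in>insert i I. x k + h k) \<partial>Pi\<^sub>M (insert i I) (\<lambda>_. U))
          + ennreal (c * ((\<Sum>k\<in>insert i I. \<bar>h k\<bar>) / (2 * a)))"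
    proof -
      have "ennreal (c * ((\<Sum>k\<in>I. \<bar>h k\<bar>) / (2 * a))) + ennreal (c * (\<bar>h i\<bar> / (2 * a)))
          = ennreal (c * ((\<Sum>k\<in>insert i I. \<bar>h k\<bar>) / (2 * a)))"
        using insert.hyps a c
        by (subst ennreal_plus[symmetric]) (auto simp: sum_nonneg field_simps)
      then show ?thesis by (simp only: add.assoc)
    qed
    finally show ?case .
  qed
  then show ?thesis unfolding U_def .
qed

section \<open>The cube of parameters, the clipped loss and sums over vertices\<close>

text \<open>Indexing the corners by sets makes an edge in direction \<open>j\<close> the pair of
  \<open>S\<close> and \<open>insert j S\<close> with \<open>j \<notin> S\<close>.\<close>

definition vertex :: "real ^ 'p ^ 'p \<Rightarrow> real \<Rightarrow> 'p set \<Rightarrow> real ^ 'p"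
  where "vertex Q \<delta> S = Q *v (\<chi> j. if j \<in> S then \<delta> else 0)"

text \<open>The projection onto \<open>[0, \<delta>]\<close> for positive \<open>\<delta>\<close>.
  It keeps the loss bounded, which turns a large expected loss into a large loss with positive
  probability.\<close>

definition clip :: "real \<Rightarrow> real \<Rightarrow> real"
  where "clip \<delta> t = max 0 (min \<delta> t)"

text \<open>\<open>x v* Q\<close> lists the inner products of \<open>x\<close> with the columns of
  \<open>Q\<close>, so for orthogonal \<open>Q\<close> this is the loss along one axis of the cube.
  The Boolean \<open>s\<close> stands for the only property of a vertex that matters here, namely on
  which of two opposite faces it lies.\<close>

definition coord_loss :: "((nat \<Rightarrow> (real ^ 'p) \<times> real) \<Rightarrow> real ^ 'p) \<Rightarrow> real ^ 'p ^ 'p \<Rightarrow> real \<Rightarrow> 'p \<Rightarrow> bool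
    \<Rightarrow> (nat \<Rightarrow> (real ^ 'p) \<times> real) \<Rightarrow> real"
  where "coord_loss b Q \<delta> j s y = (clip \<delta> ((b y v* Q) $ j) - (if s then \<delta> else 0))\<^sup>2"

lemma measurable_coord_loss [measurable]:
  fixes b :: "(nat \<Rightarrow> (real ^ 'p) \<times> real) \<Rightarrow> real ^ 'p"
  assumes "b \<in> estimators n"
  shows "coord_loss b Q \<delta> j s \<in> borel_measurable (Pi\<^sub>M {1..n} (\<lambda>_. borel \<Otimes>\<^sub>M borel))"
proof -
  have b[measurable]: "b \<in> borel_measurable (Pi\<^sub>M {1..n} (\<lambda>_. borel \<Otimes>\<^sub>M borel))"
    using assms by (simp add: estimators_def)
  have "continuous_on UNIV (\<lambda>x::real^'p. (x v* Q) $ j)"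
    by (simp add: vector_matrix_mult_def continuous_intros)
  then have [measurable]: "(\<lambda>x::real^'p. (x v* Q) $ j) \<in> borel_measurable borel"
    by (rule borel_measurable_continuous_onI)
  show ?thesis
    unfolding coord_loss_def[abs_def] clip_def by measurable
qed

lemma coord_loss_nonneg: "0 \<le> coord_loss b Q \<delta> j s y"
  by (simp add: coord_loss_def)

lemma coord_loss_le: "\<delta> > 0 \<Longrightarrow> coord_loss b Q \<delta> j s y \<le> \<delta>\<^sup>2"
  unfolding coord_loss_def clip_def by (rule abs_le_square_iff[THEN iffD1]) auto

text \<open>The squared distances from a point to \<open>0\<close> and to \<open>\<delta>\<close>
  have their smallest sum at the midpoint.\<close>

lemma coord_loss_sum_ge: "\<delta>\<^sup>2 / 2 \<le> coord_loss b Q \<delta> j False y + coord_loss b Q \<delta> j True y"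
proof -
  have "\<delta>\<^sup>2 / 2 \<le> t\<^sup>2 + (t - \<delta>)\<^sup>2" for t
  proof -
    have "t\<^sup>2 + (t - \<delta>)\<^sup>2 - \<delta>\<^sup>2 / 2 = 2 * (t - \<delta> / 2)\<^sup>2"
      by (simp add: power2_eq_square algebra_simps)
    moreover have "0 \<le> (t - \<delta> / 2)\<^sup>2" by simp
    ultimately show ?thesis by linarith
  qed
  then show ?thesis by (simp add: coord_loss_def)
qed

lemma norm_vector_matrix_orthogonal:
  assumes "orthogonal_matrix (Q :: real ^ 'p ^ 'p)"
  shows "norm (x v* Q) = norm x"
proof -
  have "Q *v (x v* Q) = (Q ** transpose Q) *v x"
    by (simp only: matrix_vector_mul_assoc[symmetric] transpose_matrix_vector)
  then have "Q *v (x v* Q) = x"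
    using assms by (simp add: orthogonal_matrix_def)
  then have "(x v* Q) \<bullet> (x v* Q) = x \<bullet> x"
    by (simp add: dot_lmul_matrix)
  then show ?thesis by (simp add: norm_eq_sqrt_inner)
qed

lemma vertex_coord:
  assumes "orthogonal_matrix (Q :: real ^ 'p ^ 'p)"
  shows "(vertex Q \<delta> S v* Q) $ j = (if j \<in> S then \<delta> else 0)"
proof -
  have "vertex Q \<delta> S v* Q = (transpose Q ** Q) *v (\<chi> j. if j \<in> S then \<delta> else 0)"
    by (simp only: vertex_def matrix_vector_mul_assoc[symmetric] transpose_matrix_vector)
  then show ?thesis
    using assms by (simp add: orthogonal_matrix)
qed

text \<open>Projecting onto \<open>[0, \<delta>]\<close> never increases the distance to one of its
  endpoints, and passing to the coordinates along the columns of \<open>Q\<close> preserves the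
  norm. Lower bounds for the clipped loss are therefore lower bounds for the true one.\<close>

lemma sum_coord_loss_le:
  assumes Q: "orthogonal_matrix (Q :: real ^ 'p ^ 'p)" and \<delta>: "\<delta> > 0"
  shows "(\<Sum>j\<in>UNIV. coord_loss b Q \<delta> j (j \<in> S) y) \<le> (norm (b y - vertex Q \<delta> S))\<^sup>2"
proof -
  let ?w = "(b y - vertex Q \<delta> S) v* Q"
  have "coord_loss b Q \<delta> j (j \<in> S) y \<le> (?w $ j)\<^sup>2" for j
  proof -
    have "?w $ j = (b y v* Q) $ j - (if j \<in> S then \<delta> else 0)"
      using vertex_coord[OF Q, of \<delta> S j] by (simp add: vector_matrix_mult_diff_distrib)
    then show ?thesis
      unfolding coord_loss_def clip_def
      using \<delta> by (intro abs_le_square_iff[THEN iffD1]) auto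
  qed
  then have "(\<Sum>j\<in>UNIV. coord_loss b Q \<delta> j (j \<in> S) y) \<le> (\<Sum>j\<in>UNIV. (?w $ j)\<^sup>2)"
    by (rule sum_mono)
  also have "\<dots> = (norm ?w)\<^sup>2"
    unfolding power2_norm_eq_inner inner_vec_def by (simp add: power2_eq_square)
  finally show ?thesis
    using Q by (simp add: norm_vector_matrix_orthogonal)
qed

lemma ennreal_eq_topI:
  assumes "\<And>x. ennreal x \<le> y"
  shows "y = \<top>"
proof (cases y)
  case (real r)
  with assms[of "r + 1"] show ?thesis by simp
qed

text \<open>Groups the vertices of the cube into the edges in direction \<open>j\<close>.\<close>

lemma sum_subsets_split:
  fixes f :: "'p::finite set \<Rightarrow> 'c::comm_monoid_add"
  shows "(\<Sum>S\<in>UNIV. f S) = (\<Sum>S\<in>Pow (UNIV - {j}). f S + f (insert j S))"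
proof -
  have "(UNIV :: 'p set set) = Pow (insert j (UNIV - {j}))" by auto
  also have "\<dots> = Pow (UNIV - {j}) \<union> insert j ` Pow (UNIV - {j})" by (rule Pow_insert)
  finally have "sum f UNIV = sum f (Pow (UNIV - {j}) \<union> insert j ` Pow (UNIV - {j}))"
    by (rule arg_cong)
  also have "\<dots> = sum f (Pow (UNIV - {j})) + sum f (insert j ` Pow (UNIV - {j}))"
    by (rule sum.union_disjoint) auto
  also have "sum f (insert j ` Pow (UNIV - {j})) = (\<Sum>S\<in>Pow (UNIV - {j}). f (insert j S))"
    by (subst sum.reindex) (auto intro!: inj_onI)
  finally show ?thesis by (simp add: sum.distrib)
qed

section \<open>The law of the sample: uniform noise on top of an independent design\<close>

context uniform_linear_model
begin

abbreviation design_space where "design_space \<equiv> Pi\<^sub>M {1..n} (\<lambda>_. borel :: (real ^ 'p) measure)"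

text \<open>The sample as a deterministic function of design and noise, so that the noise can be
  integrated out while the design stays fixed.\<close>

definition sample_of :: "real ^ 'p \<Rightarrow> (nat \<Rightarrow> real ^ 'p) \<Rightarrow> (nat \<Rightarrow> real) \<Rightarrow> nat \<Rightarrow> (real ^ 'p) \<times> real"
  where "sample_of \<beta> x e = (\<lambda>i\<in>{1..n}. (x i, x i \<bullet> \<beta> + e i))"

lemma observation_measurable:
  "i \<in> {1..n} \<Longrightarrow> observation X \<epsilon> \<beta> i \<in> measurable M (borel \<Otimes>\<^sub>M borel)"
  using observations_indep[of \<beta>] by (auto simp: indep_vars_def)

lemma measurable_design [measurable]: "i \<in> {1..n} \<Longrightarrow> X i \<in> borel_measurable M"
  using measurable_compose[OF observation_measurable[of i 0] measurable_fst]
  by (simp add: observation_def)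

lemma measurable_error [measurable]: "i \<in> {1..n} \<Longrightarrow> \<epsilon> i \<in> borel_measurable M"
  using measurable_compose[OF observation_measurable[of i 0] measurable_snd]
  by (simp add: observation_def)

lemma measurable_sample [measurable]:
  "sample n X \<epsilon> \<beta> \<in> measurable M (Pi\<^sub>M {1..n} (\<lambda>_. borel \<Otimes>\<^sub>M borel))"
  unfolding sample_def by (intro measurable_restrict observation_measurable)

lemma distr_errors:
  "distr M (Pi\<^sub>M {1..n} (\<lambda>_. borel)) (\<lambda>\<omega>. \<lambda>i\<in>{1..n}. \<epsilon> i \<omega>)
    = Pi\<^sub>M {1..n} (\<lambda>_. uniform_measure lborel {-a..a})"
proof -
  \<comment> \<open>At parameter \<open>0\<close> the response is the error itself, so independence
    of the observations gives independence of the errors.\<close>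
  have "indep_vars (\<lambda>_. borel) (\<lambda>i \<omega>. snd (observation X \<epsilon> 0 i \<omega>)) {1..n}"
    by (rule indep_vars_compose2[OF observations_indep]) measurable
  then have "indep_vars (\<lambda>_. borel) \<epsilon> {1..n}"
    by (simp add: observation_def)
  then have "distr M (Pi\<^sub>M {1..n} (\<lambda>_. borel)) (\<lambda>\<omega>. \<lambda>i\<in>{1..n}. \<epsilon> i \<omega>)
      = Pi\<^sub>M {1..n} (\<lambda>i. distr M borel (\<epsilon> i))"
    using indep_vars_iff_distr_eq_PiM'[of "{1..n}" \<epsilon> "\<lambda>_. borel"]
    \<comment> \<open>For \<open>n = 0\<close> the product law does not come from independence: both
      sides are probability measures on a one-point space.\<close>
    by (cases "n = 0") (auto simp: PiM_empty emeasure_distr emeasure_space_1 restrict_def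
        dest!: subset_singletonD intro!: measure_eqI)
  also have "\<dots> = Pi\<^sub>M {1..n} (\<lambda>_. uniform_measure lborel {-a..a})"
    by (rule PiM_cong) (auto simp: errors_uniform)
  finally show ?thesis .
qed

text \<open>Rectangles determine the joint law, and on a rectangle the independence of the two
  generated \<sigma>-algebras is the product rule.\<close>

lemma distr_design_errors:
  "distr M (design_space \<Otimes>\<^sub>M Pi\<^sub>M {1..n} (\<lambda>_. borel))
      (\<lambda>\<omega>. (\<lambda>i\<in>{1..n}. X i \<omega>, \<lambda>i\<in>{1..n}. \<epsilon> i \<omega>))
    = distr M design_space (\<lambda>\<omega>. \<lambda>i\<in>{1..n}. X i \<omega>)
      \<Otimes>\<^sub>M Pi\<^sub>M {1..n} (\<lambda>_. uniform_measure lborel {-a..a})"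
proof -
  let ?X = "\<lambda>\<omega>. \<lambda>i\<in>{1..n}. X i \<omega>" and ?e = "\<lambda>\<omega>. \<lambda>i\<in>{1..n}. \<epsilon> i \<omega>"
  let ?N = "Pi\<^sub>M {1..n} (\<lambda>_. borel :: real measure)"
  have X[measurable]: "?X \<in> measurable M design_space" by measurable
  have e[measurable]: "?e \<in> measurable M ?N" by measurable
  interpret DX: prob_space "distr M design_space ?X" by (rule prob_space_distr) measurable
  interpret De: prob_space "distr M ?N ?e" by (rule prob_space_distr) measurable
  have "distr M design_space ?X \<Otimes>\<^sub>M distr M ?N ?e = distr M (design_space \<Otimes>\<^sub>M ?N) (\<lambda>\<omega>. (?X \<omega>, ?e \<omega>))"
  proof (rule pair_measure_eqI)
    fix A B assume "A \<in> sets (distr M design_space ?X)" "B \<in> sets (distr M ?N ?e)"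
    then have A[measurable]: "A \<in> sets design_space" and B[measurable]: "B \<in> sets ?N" by auto
    have "?X -` A \<inter> space M \<in> sets (vimage_algebra (space M) ?X design_space)"
      "?e -` B \<inter> space M \<in> sets (vimage_algebra (space M) ?e ?N)"
      by (simp_all only: A B in_vimage_algebra)
    from indep_setD[OF design_indep_errors this]
    have "prob ((?X -` A \<inter> space M) \<inter> (?e -` B \<inter> space M))
       = prob (?X -` A \<inter> space M) * prob (?e -` B \<inter> space M)" .
    moreover have "(\<lambda>\<omega>. (?X \<omega>, ?e \<omega>)) -` (A \<times> B) \<inter> space M
       = (?X -` A \<inter> space M) \<inter> (?e -` B \<inter> space M)" by auto
    ultimately show "emeasure (distr M design_space ?X) A * emeasure (distr M ?N ?e) B
       = emeasure (distr M (design_space \<Otimes>\<^sub>M ?N) (\<lambda>\<omega>. (?X \<omega>, ?e \<omega>))) (A \<times> B)"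
      by (simp add: emeasure_distr emeasure_eq_measure ennreal_mult del: One_nat_def)
  qed (fact DX.sigma_finite_measure_axioms De.sigma_finite_measure_axioms | simp del: One_nat_def)+
  then show ?thesis unfolding distr_errors by (rule sym)
qed

lemma measurable_sample_of [measurable]:
  "(\<lambda>p. sample_of \<beta> (fst p) (snd p))
    \<in> measurable (design_space \<Otimes>\<^sub>M Pi\<^sub>M {1..n} (\<lambda>_. borel)) (Pi\<^sub>M {1..n} (\<lambda>_. borel \<Otimes>\<^sub>M borel))"
  unfolding sample_of_def by measurable

text \<open>Tonelli's theorem for the product law. The outer integral is pulled back to
  \<open>M\<close>, so that two parameters can be compared separately for each outcome of the
  design.\<close>

lemma nn_integral_sample:
  assumes f[measurable]: "f \<in> borel_measurable (Pi\<^sub>M {1..n} (\<lambda>_. borel \<Otimes>\<^sub>M borel))"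
  shows "(\<integral>\<^sup>+\<omega>. f (sample n X \<epsilon> \<beta> \<omega>) \<partial>M)
    = (\<integral>\<^sup>+\<omega>. \<integral>\<^sup>+e. f (sample_of \<beta> (\<lambda>i\<in>{1..n}. X i \<omega>) e)
        \<partial>Pi\<^sub>M {1..n} (\<lambda>_. uniform_measure lborel {-a..a}) \<partial>M)"
proof -
  let ?X = "\<lambda>\<omega>. \<lambda>i\<in>{1..n}. X i \<omega>" and ?e = "\<lambda>\<omega>. \<lambda>i\<in>{1..n}. \<epsilon> i \<omega>"
  let ?N = "Pi\<^sub>M {1..n} (\<lambda>_. borel :: real measure)"
  let ?U = "Pi\<^sub>M {1..n} (\<lambda>_. uniform_measure lborel {-a..a})"
  have X[measurable]: "?X \<in> measurable M design_space" by measurable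
  have e[measurable]: "?e \<in> measurable M ?N" by measurable
  have [measurable_cong]: "sets ?U = sets ?N" by (intro sets_PiM_cong) auto
  interpret U: prob_space ?U
    by (intro prob_space_PiM prob_space_uniform_measure) (use a_pos in auto)
  have eq: "sample n X \<epsilon> \<beta> \<omega> = sample_of \<beta> (?X \<omega>) (?e \<omega>)" for \<omega>
    by (auto simp: sample_def sample_of_def observation_def)
  have "(\<integral>\<^sup>+\<omega>. f (sample n X \<epsilon> \<beta> \<omega>) \<partial>M)
     = (\<integral>\<^sup>+p. f (sample_of \<beta> (fst p) (snd p)) \<partial>distr M (design_space \<Otimes>\<^sub>M ?N) (\<lambda>\<omega>. (?X \<omega>, ?e \<omega>)))"
    by (subst nn_integral_distr) (auto simp: eq simp del: One_nat_def)
  also have "\<dots> = (\<integral>\<^sup>+x. \<integral>\<^sup>+e. f (sample_of \<beta> x e) \<partial>?U \<partial>distr M design_space ?X)"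
    unfolding distr_design_errors by (subst U.nn_integral_fst[symmetric]) (auto simp del: One_nat_def)
  also have "\<dots> = (\<integral>\<^sup>+\<omega>. \<integral>\<^sup>+e. f (sample_of \<beta> (?X \<omega>) e) \<partial>?U \<partial>M)"
  proof -
    have "(\<lambda>p. f (sample_of \<beta> (fst p) (snd p))) \<in> borel_measurable (design_space \<Otimes>\<^sub>M ?U)"
      by measurable
    from U.borel_measurable_nn_integral_fst[OF this]
    have "(\<lambda>x. \<integral>\<^sup>+e. f (sample_of \<beta> x e) \<partial>?U) \<in> borel_measurable design_space" by simp
    with X show ?thesis by (simp add: nn_integral_distr del: One_nat_def)
  qed
  finally show ?thesis .
qed

section \<open>Comparing two parameters\<close>

text \<open>With the design fixed, replacing \<open>\<beta>\<close> by \<open>\<beta>'\<close>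
  shifts each error by a constant. The shift bound applies for every \<open>\<omega>\<close> and is
  then integrated over the design.\<close>

lemma nn_integral_sample_le:
  assumes f[measurable]: "f \<in> borel_measurable (Pi\<^sub>M {1..n} (\<lambda>_. borel \<Otimes>\<^sub>M borel))"
    and c: "c \<ge> 0" and le: "\<And>y. f y \<le> ennreal c"
  shows "(\<integral>\<^sup>+\<omega>. f (sample n X \<epsilon> \<beta> \<omega>) \<partial>M)
    \<le> (\<integral>\<^sup>+\<omega>. f (sample n X \<epsilon> \<beta>' \<omega>) \<partial>M)
      + ennreal (c / (2 * a)) * (\<integral>\<^sup>+\<omega>. ennreal (\<Sum>i=1..n. \<bar>X i \<omega> \<bullet> (\<beta> - \<beta>')\<bar>) \<partial>M)"
proof -
  let ?U = "Pi\<^sub>M {1..n} (\<lambda>_. uniform_measure lborel {-a..a})"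
  let ?N = "Pi\<^sub>M {1..n} (\<lambda>_. borel :: real measure)"
  have U[measurable_cong]: "sets ?U = sets ?N" by (intro sets_PiM_cong) auto
  interpret U: prob_space ?U
    by (intro prob_space_PiM prob_space_uniform_measure) (use a_pos in auto)
  let ?d = "\<lambda>\<omega>. \<Sum>i=1..n. \<bar>X i \<omega> \<bullet> (\<beta> - \<beta>')\<bar>"
  define g where "g \<beta> \<omega> = (\<integral>\<^sup>+e. f (sample_of \<beta> (\<lambda>i\<in>{1..n}. X i \<omega>) e) \<partial>?U)" for \<beta> \<omega>
  have gm[measurable]: "g \<beta>' \<in> borel_measurable M"
  proof -
    have "(\<lambda>p. (\<lambda>i\<in>{1..n}. X i (fst p), snd p)) \<in> measurable (M \<Otimes>\<^sub>M ?U) (design_space \<Otimes>\<^sub>M ?N)"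
      by measurable
    from measurable_compose[OF this measurable_compose[OF measurable_sample_of f]]
    have "(\<lambda>p. f (sample_of \<beta>' (\<lambda>i\<in>{1..n}. X i (fst p)) (snd p))) \<in> borel_measurable (M \<Otimes>\<^sub>M ?U)"
      by (simp del: One_nat_def)
    from U.borel_measurable_nn_integral_fst[OF this]
    show ?thesis by (simp add: g_def[abs_def])
  qed
  have "g \<beta> \<omega> \<le> g \<beta>' \<omega> + ennreal (c / (2 * a)) * ennreal (?d \<omega>)" for \<omega>
  proof -
    let ?x = "\<lambda>i\<in>{1..n}. X i \<omega>"
    let ?h = "\<lambda>i. X i \<omega> \<bullet> (\<beta>' - \<beta>)"
    have m: "(\<lambda>e. f (sample_of \<beta> ?x e)) \<in> borel_measurable ?U"
      unfolding sample_of_def by measurable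
    have "sample_of \<beta> ?x (\<lambda>i\<in>{1..n}. e i + ?h i) = sample_of \<beta>' ?x e" for e
      by (auto simp: sample_of_def inner_diff_right)
    with nn_integral_PiM_uniform_shift_le[OF _ m a_pos c le, of ?h]
    have "g \<beta> \<omega> \<le> g \<beta>' \<omega> + ennreal (c * ((\<Sum>i\<in>{1..n}. \<bar>?h i\<bar>) / (2 * a)))"
      by (simp add: g_def del: One_nat_def)
    also have "(\<Sum>i\<in>{1..n}. \<bar>?h i\<bar>) = ?d \<omega>"
      by (intro sum.cong) (auto simp: inner_diff_right)
    finally show ?thesis
      using c a_pos by (simp add: ennreal_mult[symmetric] sum_nonneg del: One_nat_def)
  qed
  then have "(\<integral>\<^sup>+\<omega>. g \<beta> \<omega> \<partial>M) \<le> (\<integral>\<^sup>+\<omega>. g \<beta>' \<omega> + ennreal (c / (2 * a)) * ennreal (?d \<omega>) \<partial>M)"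
    by (rule nn_integral_mono)
  also have "\<dots> = (\<integral>\<^sup>+\<omega>. g \<beta>' \<omega> \<partial>M) + ennreal (c / (2 * a)) * (\<integral>\<^sup>+\<omega>. ennreal (?d \<omega>) \<partial>M)"
    by (subst nn_integral_add) (auto simp: nn_integral_cmult simp del: One_nat_def)
  finally show ?thesis
    by (simp add: nn_integral_sample g_def del: One_nat_def)
qed

text \<open>
  Le Cam's two-point argument; truncating \<open>f\<close> at \<open>c\<close> avoids losing a factor in the constant.
\<close>

lemma two_point_lower_bound:
  assumes f[measurable]: "f \<in> borel_measurable (Pi\<^sub>M {1..n} (\<lambda>_. borel \<Otimes>\<^sub>M borel))"
    and g[measurable]: "g \<in> borel_measurable (Pi\<^sub>M {1..n} (\<lambda>_. borel \<Otimes>\<^sub>M borel))"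
    and c: "c \<ge> 0" and le: "\<And>y. ennreal c \<le> f y + g y"
    and close: "(\<integral>\<^sup>+\<omega>. ennreal (\<Sum>i=1..n. \<bar>X i \<omega> \<bullet> (\<beta>' - \<beta>)\<bar>) \<partial>M) \<le> ennreal a"
  shows "ennreal (c / 2)
    \<le> (\<integral>\<^sup>+\<omega>. f (sample n X \<epsilon> \<beta> \<omega>) \<partial>M) + (\<integral>\<^sup>+\<omega>. g (sample n X \<epsilon> \<beta>' \<omega>) \<partial>M)" (is "_ \<le> ?F + ?G")
proof -
  define f' where "f' y = min (f y) (ennreal c)" for y
  have f'[measurable]: "f' \<in> borel_measurable (Pi\<^sub>M {1..n} (\<lambda>_. borel \<Otimes>\<^sub>M borel))"
    unfolding f'_def by measurable
  \<comment> \<open>Where the truncation is active, \<open>f'\<close> alone already equals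
    \<open>c\<close>.\<close>
  have "ennreal c \<le> f' y + g y" for y
    using le[of y] by (auto simp: f'_def min_def add_increasing2)
  then have "(\<integral>\<^sup>+\<omega>. ennreal c \<partial>M)
      \<le> (\<integral>\<^sup>+\<omega>. f' (sample n X \<epsilon> \<beta>' \<omega>) + g (sample n X \<epsilon> \<beta>' \<omega>) \<partial>M)"
    by (intro nn_integral_mono)
  also have "\<dots> = (\<integral>\<^sup>+\<omega>. f' (sample n X \<epsilon> \<beta>' \<omega>) \<partial>M) + ?G"
    by (rule nn_integral_add) measurable
  also have "(\<integral>\<^sup>+\<omega>. f' (sample n X \<epsilon> \<beta>' \<omega>) \<partial>M) \<le> (\<integral>\<^sup>+\<omega>. f' (sample n X \<epsilon> \<beta> \<omega>) \<partial>M)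
      + ennreal (c / (2 * a)) * (\<integral>\<^sup>+\<omega>. ennreal (\<Sum>i=1..n. \<bar>X i \<omega> \<bullet> (\<beta>' - \<beta>)\<bar>) \<partial>M)"
    by (rule nn_integral_sample_le[OF f' c]) (auto simp: f'_def)
  also have "\<dots> \<le> ?F + ennreal (c / (2 * a)) * ennreal a"
    by (intro add_mono mult_left_mono close nn_integral_mono) (auto simp: f'_def)
  also have "ennreal (c / (2 * a)) * ennreal a = ennreal (c / 2)"
    using a_pos c by (simp add: ennreal_mult[symmetric])
  finally have "ennreal c \<le> ?F + ennreal (c / 2) + ?G"
    by (simp add: emeasure_space_1)
  \<comment> \<open>Closeness costs half of \<open>c\<close>. Writing \<open>c\<close> as two halves
    lets this finite amount be cancelled in \<open>[0, \<infinity>]\<close>.\<close>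
  moreover have "ennreal c = ennreal (c / 2) + ennreal (c / 2)"
    using c by (simp add: ennreal_plus[symmetric] del: ennreal_plus)
  ultimately have "ennreal (c / 2) + ennreal (c / 2) \<le> ennreal (c / 2) + (?F + ?G)"
    by (simp add: ac_simps)
  then show ?thesis
    by (rule ennreal_add_left_cancel_le[THEN iffD1, THEN disjE]) auto
qed

section \<open>From edges of the cube to one bad vertex\<close>

text \<open>The two-point bound on one edge. Its endpoints differ by \<open>\<delta>\<close> times
  column \<open>j\<close> of \<open>Q\<close>, so \<open>close\<close> bounds the expected total
  shift by \<open>a\<close>.\<close>

lemma coord_risk_ge:
  assumes b[measurable]: "b \<in> estimators n" and \<delta>: "\<delta> > 0"
    and close: "(\<integral>\<^sup>+\<omega>. ennreal (\<Sum>i=1..n. \<bar>(X i \<omega> v* Q) $ j\<bar>) \<partial>M) \<le> ennreal (a / \<delta>)"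
    and j: "j \<notin> S"
  shows "ennreal (\<delta>\<^sup>2 / 4)
    \<le> (\<integral>\<^sup>+\<omega>. coord_loss b Q \<delta> j False (sample n X \<epsilon> (vertex Q \<delta> S) \<omega>) \<partial>M)
      + (\<integral>\<^sup>+\<omega>. coord_loss b Q \<delta> j True (sample n X \<epsilon> (vertex Q \<delta> (insert j S)) \<omega>) \<partial>M)"
proof -
  \<comment> \<open>One factor \<open>1 / 2\<close> is the minimal sum of the two losses, the other
    is the loss in the two-point bound.\<close>
  have "ennreal (\<delta>\<^sup>2 / 2 / 2)
    \<le> (\<integral>\<^sup>+\<omega>. coord_loss b Q \<delta> j False (sample n X \<epsilon> (vertex Q \<delta> S) \<omega>) \<partial>M)
      + (\<integral>\<^sup>+\<omega>. coord_loss b Q \<delta> j True (sample n X \<epsilon> (vertex Q \<delta> (insert j S)) \<omega>) \<partial>M)"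
  proof (rule two_point_lower_bound)
    show "ennreal (\<delta>\<^sup>2 / 2)
        \<le> ennreal (coord_loss b Q \<delta> j False y) + ennreal (coord_loss b Q \<delta> j True y)" for y
      using coord_loss_sum_ge[of \<delta> b Q j y]
      by (simp add: ennreal_plus[symmetric] coord_loss_nonneg del: ennreal_plus)
    have "vertex Q \<delta> (insert j S) - vertex Q \<delta> S = Q *v axis j \<delta>"
      unfolding vertex_def matrix_vector_mult_diff_distrib[symmetric]
      using j by (intro arg_cong[where f = "(*v) Q"]) (auto simp: vec_eq_iff axis_def)
    then have eq: "\<bar>x \<bullet> (vertex Q \<delta> (insert j S) - vertex Q \<delta> S)\<bar> = \<delta> * \<bar>(x v* Q) $ j\<bar>" for x
      using \<delta> by (simp add: dot_lmul_matrix[symmetric] inner_axis abs_mult)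
    have "continuous_on UNIV (\<lambda>x::real^'p. (x v* Q) $ j)"
      by (simp add: vector_matrix_mult_def continuous_intros)
    then have [measurable]: "(\<lambda>x::real^'p. (x v* Q) $ j) \<in> borel_measurable borel"
      by (rule borel_measurable_continuous_onI)
    have "(\<integral>\<^sup>+\<omega>. ennreal (\<Sum>i=1..n. \<bar>X i \<omega> \<bullet> (vertex Q \<delta> (insert j S) - vertex Q \<delta> S)\<bar>) \<partial>M)
        = (\<integral>\<^sup>+\<omega>. ennreal \<delta> * ennreal (\<Sum>i=1..n. \<bar>(X i \<omega> v* Q) $ j\<bar>) \<partial>M)"
      using \<delta> by (simp add: eq sum_distrib_left[symmetric] ennreal_mult sum_nonneg del: One_nat_def)
    also have "\<dots> = ennreal \<delta> * (\<integral>\<^sup>+\<omega>. ennreal (\<Sum>i=1..n. \<bar>(X i \<omega> v* Q) $ j\<bar>) \<partial>M)"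
      by (rule nn_integral_cmult) measurable
    also have "\<dots> \<le> ennreal \<delta> * ennreal (a / \<delta>)"
      by (intro mult_left_mono close) simp
    also have "\<dots> = ennreal a"
      using \<delta> a_pos by (simp add: ennreal_mult[symmetric])
    finally show "(\<integral>\<^sup>+\<omega>. ennreal (\<Sum>i=1..n. \<bar>X i \<omega> \<bullet> (vertex Q \<delta> (insert j S) - vertex Q \<delta> S)\<bar>) \<partial>M)
       \<le> ennreal a" .
    show "(\<lambda>y. ennreal (coord_loss b Q \<delta> j False y)) \<in> borel_measurable (Pi\<^sub>M {1..n} (\<lambda>_. borel \<Otimes>\<^sub>M borel))"
      "(\<lambda>y. ennreal (coord_loss b Q \<delta> j True y)) \<in> borel_measurable (Pi\<^sub>M {1..n} (\<lambda>_. borel \<Otimes>\<^sub>M borel))"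
      by measurable
  qed simp
  then show ?thesis by simp
qed

text \<open>
  Assouad's argument: averaged over the \<open>2 ^ p\<close> vertices of a cube with side \<open>\<delta>\<close> and axes along the
  columns of \<open>Q\<close>, each coordinate of the estimator clipped to the cube contributes at least \<open>\<delta>\<^sup>2 / 8\<close>.
\<close>

lemma assouad_vertex:
  fixes b :: "(nat \<Rightarrow> (real ^ 'p) \<times> real) \<Rightarrow> real ^ 'p"
  assumes b[measurable]: "b \<in> estimators n" and \<delta>: "\<delta> > 0"
    and close: "\<And>j. (\<integral>\<^sup>+\<omega>. ennreal (\<Sum>i=1..n. \<bar>(X i \<omega> v* Q) $ j\<bar>) \<partial>M) \<le> ennreal (a / \<delta>)"
  obtains S where "ennreal (real CARD('p) * \<delta>\<^sup>2 / 8)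
    \<le> (\<integral>\<^sup>+\<omega>. ennreal (\<Sum>j\<in>UNIV. coord_loss b Q \<delta> j (j \<in> S) (sample n X \<epsilon> (vertex Q \<delta> S) \<omega>)) \<partial>M)"
proof -
  define r where "r j S = (\<integral>\<^sup>+\<omega>. coord_loss b Q \<delta> j (j \<in> S) (sample n X \<epsilon> (vertex Q \<delta> S) \<omega>) \<partial>M)"
    for j :: 'p and S :: "'p set"
  define R where "R S = (\<Sum>j\<in>UNIV. r j S)" for S
  have R: "R S = (\<integral>\<^sup>+\<omega>. ennreal (\<Sum>j\<in>UNIV. coord_loss b Q \<delta> j (j \<in> S)
      (sample n X \<epsilon> (vertex Q \<delta> S) \<omega>)) \<partial>M)" for S
    unfolding R_def r_def
    by (subst nn_integral_sum[symmetric]) (auto simp: sum_ennreal coord_loss_nonneg)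
  have card: "real (card (Pow (UNIV - {j}))) = 2 ^ CARD('p) / 2" for j :: 'p
    using power_minus_mult[of "CARD('p)" "2::real"] by (simp add: card_Pow card_Diff_singleton)
  have "ennreal (2 ^ CARD('p) * \<delta>\<^sup>2 / 8) \<le> (\<Sum>S\<in>UNIV. r j S)" for j
  proof -
    \<comment> \<open>There are \<open>2 ^ (p - 1)\<close> edges in direction \<open>j\<close>, each
      contributing at least a quarter of the squared side.\<close>
    have "ennreal (2 ^ CARD('p) * \<delta>\<^sup>2 / 8) = of_nat (card (Pow (UNIV - {j}))) * ennreal (\<delta>\<^sup>2 / 4)"
      unfolding ennreal_of_nat_eq_real_of_nat card by (simp add: ennreal_mult[symmetric])
    also have "\<dots> \<le> (\<Sum>S\<in>Pow (UNIV - {j}). r j S + r j (insert j S))"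
    proof (rule sum_bounded_below)
      fix S assume "S \<in> Pow (UNIV - {j})"
      then have "j \<notin> S" by auto
      from coord_risk_ge[OF b \<delta> close this] this
      show "ennreal (\<delta>\<^sup>2 / 4) \<le> r j S + r j (insert j S)" by (simp add: r_def)
    qed
    also have "\<dots> = (\<Sum>S\<in>UNIV. r j S)" by (rule sum_subsets_split[symmetric])
    finally show ?thesis .
  qed
  then have "of_nat CARD('p) * ennreal (2 ^ CARD('p) * \<delta>\<^sup>2 / 8) \<le> (\<Sum>j\<in>UNIV. \<Sum>S\<in>UNIV. r j S)"
    by (intro sum_bounded_below)
  also have "\<dots> = (\<Sum>S\<in>UNIV. R S)" unfolding R_def by (rule sum.swap)
  \<comment> \<open>A vertex of largest risk has at least the average risk over all
    \<open>2 ^ p\<close> vertices.\<close>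
  also obtain S where S: "\<And>T. R T \<le> R S"
  proof -
    have "Max (range R) \<in> range R" by (rule Max_in) auto
    then obtain S where "Max (range R) = R S" by (rule imageE)
    then show ?thesis using that[of S] by (metis Max_ge finite finite_imageI rangeI)
  qed
  have "(\<Sum>S\<in>UNIV. R S) \<le> of_nat CARD('p set) * R S"
    by (rule sum_bounded_above) (rule S)
  finally have "of_nat CARD('p) * ennreal (2 ^ CARD('p) * \<delta>\<^sup>2 / 8) \<le> of_nat CARD('p set) * R S" .
  also have "of_nat CARD('p) * ennreal (2 ^ CARD('p) * \<delta>\<^sup>2 / 8)
      = of_nat CARD('p set) * ennreal (real CARD('p) * \<delta>\<^sup>2 / 8)"
    by (simp add: card_UNIV_set ennreal_of_nat_eq_real_of_nat ennreal_mult[symmetric] ac_simps)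
  finally have "ennreal (real CARD('p) * \<delta>\<^sup>2 / 8) \<le> R S"
    by (subst (asm) ennreal_mult_le_mult_iff) (auto simp: power_eq_top_ennreal)
  then show ?thesis using that R by simp
qed

section \<open>Lower bounds in expectation and in probability for a single estimator\<close>

text \<open>The strict inequality \<open>size\<close> yields a suitable \<open>Q\<close> without
  asking whether the infimum is attained. The same bad vertex serves the expectation and every
  threshold \<open>t\<close>.\<close>

lemma risk_lower_bounds:
  fixes b :: "(nat \<Rightarrow> (real ^ 'p) \<times> real) \<Rightarrow> real ^ 'p"
  assumes b[measurable]: "b \<in> estimators n" and \<delta>: "\<delta> > 0"
    and size: "design_size M n X < ennreal (a / \<delta>)"
  obtains \<beta> where
    "ennreal (real CARD('p) * \<delta>\<^sup>2 / 8) \<le> (\<integral>\<^sup>+\<omega>. ennreal ((norm (b (sample n X \<epsilon> \<beta> \<omega>) - \<beta>))\<^sup>2) \<partial>M)"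
    "\<And>t. t \<ge> 0 \<Longrightarrow> t\<^sup>2 \<le> real CARD('p) * \<delta>\<^sup>2 / 16 \<Longrightarrow>
      1 / 16 \<le> prob {\<omega> \<in> space M. t \<le> norm (b (sample n X \<epsilon> \<beta> \<omega>) - \<beta>)}"
proof -
  let ?p = "real CARD('p)"
  have bm[measurable]: "b \<in> borel_measurable (Pi\<^sub>M {1..n} (\<lambda>_. borel \<Otimes>\<^sub>M borel))"
    using b by (simp add: estimators_def)
  obtain Q :: "real ^ 'p ^ 'p" where Q: "orthogonal_matrix Q"
    and "(MAX j. \<integral>\<^sup>+\<omega>. ennreal (\<Sum>i=1..n. \<bar>(X i \<omega> v* Q) $ j\<bar>) \<partial>M) < ennreal (a / \<delta>)"
    using size unfolding design_size_def INF_less_iff by blast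
  then have "(\<integral>\<^sup>+\<omega>. ennreal (\<Sum>i=1..n. \<bar>(X i \<omega> v* Q) $ j\<bar>) \<partial>M) \<le> ennreal (a / \<delta>)" for j
    by (subst (asm) Max_less_iff) (auto simp: less_imp_le)
  from assouad_vertex[OF b \<delta> this] obtain S where S: "ennreal (?p * \<delta>\<^sup>2 / 8)
    \<le> (\<integral>\<^sup>+\<omega>. ennreal (\<Sum>j\<in>UNIV. coord_loss b Q \<delta> j (j \<in> S) (sample n X \<epsilon> (vertex Q \<delta> S) \<omega>)) \<partial>M)"
    (is "_ \<le> (\<integral>\<^sup>+\<omega>. ennreal (?L \<omega>) \<partial>M)") by blast
  let ?d = "\<lambda>\<omega>. norm (b (sample n X \<epsilon> (vertex Q \<delta> S) \<omega>) - vertex Q \<delta> S)"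
  have Ld: "?L \<omega> \<le> (?d \<omega>)\<^sup>2" for \<omega>
    by (rule sum_coord_loss_le[OF Q \<delta>])
  have Lp: "?L \<omega> \<le> ?p * \<delta>\<^sup>2" for \<omega>
  proof -
    have "?L \<omega> \<le> (\<Sum>j\<in>(UNIV :: 'p set). \<delta>\<^sup>2)"
      by (intro sum_mono coord_loss_le \<delta>)
    then show ?thesis by simp
  qed
  show ?thesis
  proof (rule that[of "vertex Q \<delta> S"])
    show "ennreal (?p * \<delta>\<^sup>2 / 8) \<le> (\<integral>\<^sup>+\<omega>. ennreal ((?d \<omega>)\<^sup>2) \<partial>M)"
      by (rule order_trans[OF S]) (intro nn_integral_mono ennreal_leI Ld)
    fix t :: real assume t: "t \<ge> 0" "t\<^sup>2 \<le> ?p * \<delta>\<^sup>2 / 16"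
    let ?A = "{\<omega> \<in> space M. t \<le> ?d \<omega>}"
    have A[measurable]: "?A \<in> sets M" by measurable
    \<comment> \<open>A reverse Markov inequality: the clipped loss is at most its global bound on
      \<open>?A\<close> and at most the square of \<open>t\<close> elsewhere. The latter takes at
      most half of the \<open>1 / 8\<close> that the mean guarantees, so \<open>1 / 16\<close> is
      left for the probability.\<close>
    have "ennreal (?p * \<delta>\<^sup>2 / 8) \<le> (\<integral>\<^sup>+\<omega>. ennreal (?p * \<delta>\<^sup>2) * indicator ?A \<omega> + ennreal (t\<^sup>2) \<partial>M)"
    proof (rule order_trans[OF S], rule nn_integral_mono)
      fix \<omega> assume \<omega>: "\<omega> \<in> space M"
      show "ennreal (?L \<omega>) \<le> ennreal (?p * \<delta>\<^sup>2) * indicator ?A \<omega> + ennreal (t\<^sup>2)"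
      proof (cases "\<omega> \<in> ?A")
        case True
        then show ?thesis using ennreal_leI[OF Lp[of \<omega>]] by (simp add: add_increasing2)
      next
        case False
        with \<omega> have "?d \<omega> \<le> t" by auto
        then have "(?d \<omega>)\<^sup>2 \<le> t\<^sup>2" by (intro power_mono) auto
        then have "?L \<omega> \<le> t\<^sup>2" using Ld[of \<omega>] by linarith
        with False show ?thesis by (auto simp: ennreal_leI)
      qed
    qed
    also have "\<dots> = ennreal (?p * \<delta>\<^sup>2) * ennreal (prob ?A) + ennreal (t\<^sup>2)"
      by (subst nn_integral_add) (auto simp: nn_integral_cmult_indicator emeasure_eq_measure prob_space)
    also have "\<dots> = ennreal (?p * \<delta>\<^sup>2 * prob ?A + t\<^sup>2)"
      by (simp add: ennreal_mult ennreal_plus)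
    finally have "?p * \<delta>\<^sup>2 / 8 \<le> ?p * \<delta>\<^sup>2 * prob ?A + t\<^sup>2"
      by (subst (asm) ennreal_le_iff) auto
    with t(2) have "?p * \<delta>\<^sup>2 * (1 / 16) \<le> ?p * \<delta>\<^sup>2 * prob ?A" by linarith
    then show "1 / 16 \<le> prob ?A"
      using \<delta> by (subst (asm) mult_le_cancel_left_pos) auto
  qed
qed

end

section \<open>The choice of the side length, and the degenerate design sizes\<close>

theorem theorem2p19:
  fixes M :: "'w measure" and n :: nat and a :: real
    and X :: "nat \<Rightarrow> 'w \<Rightarrow> real ^ 'p" and \<epsilon> :: "nat \<Rightarrow> 'w \<Rightarrow> real"
  assumes "uniform_linear_model M n a X \<epsilon>"
  shows "(INF b\<in>estimators n. SUP \<beta>.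
            \<integral>\<^sup>+\<omega>. ennreal ((norm (b (sample n X \<epsilon> \<beta> \<omega>) - \<beta>))\<^sup>2) \<partial>M) \<ge> rate M n a X
    \<and> (rate M n a X < \<infinity> \<longrightarrow>
         (INF b\<in>estimators n. SUP \<beta>.
            emeasure M {\<omega> \<in> space M.
              norm (b (sample n X \<epsilon> \<beta> \<omega>) - \<beta>) \<ge> sqrt (enn2real (rate M n a X) / 2)}) \<ge> 1 / 2 ^ 8)"
    (is "?risk \<ge> _ \<and> (_ \<longrightarrow> ?prob \<ge> _)")
proof -
  interpret uniform_linear_model M n a X \<epsilon> by fact
  let ?p = "real CARD('p)"
  have risk: "ennreal (?p * \<delta>\<^sup>2 / 8) \<le> ?risk"
    if \<delta>: "\<delta> > 0" "design_size M n X < ennreal (a / \<delta>)" for \<delta>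
  proof (rule INF_greatest)
    fix b :: "(nat \<Rightarrow> (real ^ 'p) \<times> real) \<Rightarrow> real ^ 'p" assume "b \<in> estimators n"
    from risk_lower_bounds[OF this \<delta>] obtain \<beta> where
      "ennreal (?p * \<delta>\<^sup>2 / 8) \<le> (\<integral>\<^sup>+\<omega>. ennreal ((norm (b (sample n X \<epsilon> \<beta> \<omega>) - \<beta>))\<^sup>2) \<partial>M)"
      by blast
    then show "ennreal (?p * \<delta>\<^sup>2 / 8)
        \<le> (SUP \<beta>. \<integral>\<^sup>+\<omega>. ennreal ((norm (b (sample n X \<epsilon> \<beta> \<omega>) - \<beta>))\<^sup>2) \<partial>M)"
      by (rule SUP_upper2[OF UNIV_I])
  qed
  have one_256: "(1 / 2 ^ 8 :: ennreal) = ennreal (1 / 256)"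
    by (simp add: divide_ennreal[symmetric])
  consider "design_size M n X = 0" | "design_size M n X = \<top>"
    | d where "d > 0" "design_size M n X = ennreal d"
    by (cases "design_size M n X") (auto simp: le_less)
  then show ?thesis
  proof cases
    \<comment> \<open>With design size \<open>0\<close> every side length is admissible, so the risk
      exceeds every real number. The statement on probabilities is vacuous, as the rate is
      infinite.\<close>
    case 1
    then have rate: "rate M n a X = \<top>"
      using a_pos by (simp add: rate_def ennreal_divide_eq_top_iff)
    have "ennreal x \<le> ?risk" for x
    proof -
      \<comment> \<open>Chosen so that already one coordinate contributes \<open>max 1 x\<close>;
        the dimension is at least one.\<close>
      define \<delta> where "\<delta> = sqrt (8 * max 1 x)"
      have \<delta>: "\<delta> > 0" "\<delta>\<^sup>2 = 8 * max 1 x" by (auto simp: \<delta>_def)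
      have "1 * max 1 x \<le> ?p * max 1 x"
        by (intro mult_right_mono) (auto simp: Suc_leI)
      then have "ennreal x \<le> ennreal (?p * \<delta>\<^sup>2 / 8)" by (intro ennreal_leI) (simp add: \<delta>(2))
      also have "\<dots> \<le> ?risk" using \<delta>(1) a_pos by (intro risk) (auto simp: 1)
      finally show ?thesis .
    qed
    then have "?risk = \<top>" by (rule ennreal_eq_topI)
    then have "rate M n a X \<le> ?risk" by (simp only: top_greatest)
    with rate show ?thesis by simp
  next
    \<comment> \<open>Here the threshold is \<open>0\<close>, so the event in question is the whole
      space.\<close>
    case 2
    then have rate: "rate M n a X = 0"
      by (simp add: rate_def power2_eq_square ennreal_mult_top)
    have "(1 / 2 ^ 8 :: ennreal) \<le> 1"
      by (subst one_256, subst ennreal_1[symmetric], rule ennreal_leI) simp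
    then have "1 / 2 ^ 8 \<le> ?prob"
      by (simp add: rate emeasure_space_1 le_INF_iff)
    with rate show ?thesis by simp
  next
    case 3
    \<comment> \<open>The factor \<open>sqrt 2\<close> makes the Assouad bound equal to the rate,
      and \<open>a / \<delta> = sqrt 2 * d\<close> exceeds \<open>d\<close> strictly, as the choice
      of \<open>Q\<close> demands.\<close>
    define \<delta> where "\<delta> = a / (sqrt 2 * d)"
    have \<delta>: "\<delta> > 0" using a_pos 3 by (simp add: \<delta>_def)
    have eq: "?p * \<delta>\<^sup>2 / 8 = a\<^sup>2 * ?p / (16 * d\<^sup>2)"
      by (simp add: \<delta>_def power_divide power_mult_distrib field_simps)
    have rate: "rate M n a X = ennreal (?p * \<delta>\<^sup>2 / 8)"
    proof -
      have "16 * (ennreal d)\<^sup>2 = ennreal (16 * d\<^sup>2)"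
        using 3(1) by (simp add: ennreal_power ennreal_mult)
      then show ?thesis
        unfolding eq rate_def 3(2) using 3(1) by (simp only:) (rule divide_ennreal, auto)
    qed
    have "d < sqrt 2 * d" using 3(1) by simp
    also have "sqrt 2 * d = a / \<delta>" using a_pos 3(1) by (simp add: \<delta>_def)
    finally have size: "design_size M n X < ennreal (a / \<delta>)"
      using 3 by (simp add: ennreal_lessI)
    let ?t = "sqrt (enn2real (rate M n a X) / 2)"
    \<comment> \<open>The square of \<open>?t\<close> is half the rate, which is exactly the largest
      value that the probability bound admits.\<close>
    have t: "?t \<ge> 0" "?t\<^sup>2 \<le> ?p * \<delta>\<^sup>2 / 16" by (auto simp: rate)
    have "1 / 2 ^ 8 \<le> ?prob"
    proof (rule INF_greatest)
      fix b :: "(nat \<Rightarrow> (real ^ 'p) \<times> real) \<Rightarrow> real ^ 'p" assume "b \<in> estimators n"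
      from risk_lower_bounds[OF this \<delta> size] obtain \<beta> where
        "\<And>t. t \<ge> 0 \<Longrightarrow> t\<^sup>2 \<le> ?p * \<delta>\<^sup>2 / 16 \<Longrightarrow>
          1 / 16 \<le> prob {\<omega> \<in> space M. t \<le> norm (b (sample n X \<epsilon> \<beta> \<omega>) - \<beta>)}" by blast
      note this[OF t]
      then have "1 / 2 ^ 8 \<le> emeasure M {\<omega> \<in> space M. ?t \<le> norm (b (sample n X \<epsilon> \<beta> \<omega>) - \<beta>)}"
        unfolding one_256 emeasure_eq_measure by (intro ennreal_leI) linarith
      then show "1 / 2 ^ 8
          \<le> (SUP \<beta>. emeasure M {\<omega> \<in> space M. ?t \<le> norm (b (sample n X \<epsilon> \<beta> \<omega>) - \<beta>)})"
        by (rule SUP_upper2[OF UNIV_I])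
    qed
    with risk[OF \<delta> size] show ?thesis by (simp add: rate)
  qed
qed

end
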